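(* Let $S$ be a numerical semigroup with multiplicity $m$, embedding dimension $\nu$ and conductor $f+1=qm-\rho$ for some $q\in\mathbb N$ and $0\le\rho\le m-1$. If $\left(2+\frac1q\right)\nu\ge m$, then $S$ satisfies Wilf's Conjecture, i.e. $f+1\le\nu n$.
   Context: A numerical semigroup is a submonoid of $(\mathbb N,+)$ with finite complement. $f$ is its Frobenius number (largest integer not in $S$), $m$ its smallest nonzero element, $\nu$ its minimal number of generators, and $n=|\{s\in S: s<f\}|$. *)

theory Defs
  imports Complex_Main
begin

definition add_submonoid :: "nat set \<Rightarrow> bool" where
  "add_submonoid T \<longleftrightarrow> 0 \<in> T \<and> (\<forall>a\<in>T. \<forall>b\<in>T. a + b \<in> T)"

definition numerical_semigroup :: "nat set \<Rightarrow> bool" where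
  "numerical_semigroup S \<longleftrightarrow> add_submonoid S \<and> finite (- S)"

definition min_nonzero :: "nat set \<Rightarrow> nat" where
  "min_nonzero S = (LEAST s. s \<in> S \<and> s \<noteq> 0)"

text \<open>The Frobenius number is an integer, not a natural number: it is \<open>-1\<close> for \<open>S = UNIV\<close>.\<close>

definition frobenius :: "nat set \<Rightarrow> int" where
  "frobenius S = (GREATEST z. z \<notin> int ` S)"

definition embdim :: "nat set \<Rightarrow> nat" where
  "embdim S = (LEAST k. \<exists>A. finite A \<and> card A = k \<and> add_submonoid hull A = S)"

definition num_left :: "nat set \<Rightarrow> nat" where
  "num_left S = card {s \<in> S. int s < frobenius S}"

end

theory Submission imports Defs begin

text \<open>
  Write \<open>K = f + 1 = q m - \<rho>\<close> and let \<open>lev x\<close> be the number of elements below \<open>K\<close> in \<open>x + m\<nat>\<close>. Summing over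
  the Apery set gives \<open>n = q + B\<close>, where \<open>B\<close> is the sum of the levels of its nonzero elements. The
  hypothesis reads \<open>q m \<le> (2 q + 1) \<nu>\<close>, so only \<open>B \<le> q\<close> needs work. There, \<open>m - \<nu>\<close> is at most the number of
  Apery elements that are sums \<open>x + y\<close> of two nonzero Apery elements. As every Apery element is at
  most \<open>f + m\<close>, such summands have positive level and \<open>lev x + lev y \<ge> q - 1\<close>. Hence \<open>B \<le> q\<close> leaves at most three
  possible summands, so \<open>m - \<nu> \<le> 6\<close>, and what is left is a short case analysis in which equality
  \<open>lev x + lev y = q - 1\<close> forces \<open>\<rho>\<close> to be large enough.
\<close>

lemma card_3_sorted:
  assumes "card (T :: nat set) = 3"
  obtains a b c where "T = {a, b, c}" "a < b" "b < c"
proof -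
  have "length (sorted_list_of_set T) = 3" using assms by simp
  then obtain a b c where l: "sorted_list_of_set T = [a, b, c]"
    unfolding numeral_3_eq_3 length_Suc_conv length_0_conv by blast
  have "finite T" using assms card.infinite by fastforce
  then have "T = {a, b, c}" using l by (metis set_sorted_list_of_set list.simps(15) list.set(1))
  moreover have "a < b" "b < c"
    using l strict_sorted_list_of_set[of T] by auto
  ultimately show thesis using that by blast
qed

section \<open>Apery set and levels\<close>

locale semigroup_with_conductor =
  fixes S :: "nat set" and m K :: nat
  assumes zero: "0 \<in> S"
    and add_closed: "a \<in> S \<Longrightarrow> b \<in> S \<Longrightarrow> a + b \<in> S"
    and m_in: "m \<in> S" and m_pos: "0 < m"
    and m_le: "s \<in> S \<Longrightarrow> s \<noteq> 0 \<Longrightarrow> m \<le> s"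
    and conductor: "K \<le> s \<Longrightarrow> s \<in> S"
begin

text \<open>The Apery set of \<open>S\<close> with respect to \<open>m\<close>. That
  \<open>x - m\<close> lies outside \<open>S\<close> is expressed additively, since subtraction on
  \<open>nat\<close> truncates.\<close>

definition apery :: "nat set" where
  "apery = {x \<in> S. \<forall>y\<in>S. x \<noteq> y + m}"

text \<open>The truncated difference makes \<open>lev x = 0\<close> for \<open>x \<ge> K\<close>.\<close>

definition lev :: "nat \<Rightarrow> nat" where
  "lev x = (K + m - 1 - x) div m"

definition decomposables :: "nat set" where
  "decomposables = {z \<in> apery. \<exists>x\<in>apery - {0}. \<exists>y\<in>apery - {0}. z = x + y}"

lemma add_mult_closed: "x \<in> S \<Longrightarrow> x + t * m \<in> S"
proof (induction t)
  case (Suc t)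
  then have "(x + t * m) + m \<in> S" using add_closed m_in by blast
  then show ?case by (simp add: algebra_simps)
qed simp

lemma apery_le:
  assumes "x \<in> apery" shows "x + 1 \<le> K + m"
proof (rule ccontr)
  assume "\<not> ?thesis"
  then have "x - m \<in> S" "x = (x - m) + m" using conductor by auto
  then show False using assms unfolding apery_def by blast
qed

lemma finite_apery: "finite apery"
  by (rule finite_subset[of _ "{..K + m}"]) (use apery_le in fastforce)+

lemma zero_in_apery: "0 \<in> apery"
  using zero m_pos by (simp add: apery_def)

lemma apery_greater: "x \<in> apery - {0} \<Longrightarrow> m < x"
  using m_le[of x] zero by (cases "x = m") (auto simp: apery_def)

lemma apery_decomposition:
  "s \<in> S \<Longrightarrow> \<exists>x\<in>apery. \<exists>t. s = x + t * m"
proof (induction s rule: less_induct)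
  case (less s)
  show ?case
  proof (cases "s \<in> apery")
    case True
    then show ?thesis by (intro bexI[of _ s] exI[of _ 0]) auto
  next
    case False
    then obtain y where y: "y \<in> S" "s = y + m" using less.prems by (auto simp: apery_def)
    then obtain x t where "x \<in> apery" "y = x + t * m" using less.IH[of y] m_pos by auto
    then show ?thesis using y by (intro bexI[of _ x] exI[of _ "Suc t"]) auto
  qed
qed

lemma apery_add_mult_eq:
  assumes "x \<in> apery" "y \<in> apery" "y = x + t * m"
  shows "t = 0"
proof (rule ccontr)
  assume "t \<noteq> 0"
  then obtain t' where "t = Suc t'" by (cases t) auto
  then have "y = (x + t' * m) + m" using assms by simp
  moreover have "x + t' * m \<in> S" using assms add_mult_closed by (auto simp: apery_def)
  ultimately show False using assms by (auto simp: apery_def)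
qed

lemma apery_mod_inj:
  assumes "x \<in> apery" "y \<in> apery" "x mod m = y mod m"
  shows "x = y"
  using assms
proof (induction x y rule: linorder_wlog)
  case (le x y)
  then have "m dvd y - x" using mod_eq_dvd_iff_nat[of x y m] by simp
  then obtain t where "y - x = m * t" by (rule dvdE)
  then have "y = x + t * m" using le(1) by (simp add: mult.commute)
  with apery_add_mult_eq le show ?case by auto
qed auto

text \<open>Every residue class mod \<open>m\<close> meets \<open>S\<close>, as
  \<open>r + K * m\<close> is large enough, and its elements in \<open>S\<close> descend in steps of
  \<open>m\<close> to a single Apery element.\<close>

lemma card_apery: "card apery = m"
proof -
  have "bij_betw (\<lambda>x. x mod m) apery {..<m}"
  proof (rule bij_betw_imageI)
    show "inj_on (\<lambda>x. x mod m) apery" using apery_mod_inj by (auto intro: inj_onI)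
    have "r \<in> (\<lambda>x. x mod m) ` apery" if "r < m" for r
    proof -
      have "K \<le> r + K * m" using m_pos by (cases m) auto
      then obtain x t where "x \<in> apery" "r + K * m = x + t * m"
        using apery_decomposition conductor by blast
      then have "x mod m = r" using that by (metis mod_less mod_mult_self1)
      then show ?thesis using \<open>x \<in> apery\<close> by blast
    qed
    then show "(\<lambda>x. x mod m) ` apery = {..<m}" using m_pos by auto
  qed
  then show ?thesis by (simp add: bij_betw_same_card)
qed

lemma less_lev_iff: "t < lev x \<longleftrightarrow> x + t * m < K"
proof -
  have "t < lev x \<longleftrightarrow> Suc t * m \<le> K + m - 1 - x"
    unfolding lev_def using m_pos by (simp add: Suc_le_eq[symmetric] less_eq_div_iff_mult_less_eq del: mult_Suc)
  also have "\<dots> \<longleftrightarrow> x + t * m < K" using m_pos by auto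
  finally show ?thesis .
qed

lemma lev_bound: "K \<le> x + lev x * m"
  using less_lev_iff[of "lev x" x] by simp

text \<open>Each \<open>s\<close> in \<open>S\<close> is \<open>x + t * m\<close> for a unique Apery
  element \<open>x\<close> and a unique \<open>t\<close>, and \<open>s < K\<close> exactly when
  \<open>t < lev x\<close>.\<close>

lemma card_below_conductor: "card {s \<in> S. s < K} = (\<Sum>x\<in>apery. lev x)"
proof -
  have "bij_betw (\<lambda>(x, t). x + t * m) (SIGMA x:apery. {..<lev x}) {s \<in> S. s < K}"
  proof (rule bij_betw_imageI)
    show "inj_on (\<lambda>(x, t). x + t * m) (SIGMA x:apery. {..<lev x})"
    proof (rule inj_onI, clarify)
      fix x t y u
      assume a: "x \<in> apery" "y \<in> apery" "x + t * m = y + u * m"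
      then have "x = y" by (metis apery_mod_inj mod_mult_self1)
      then show "x = y \<and> t = u" using a m_pos by auto
    qed
    show "(\<lambda>(x, t). x + t * m) ` (SIGMA x:apery. {..<lev x}) = {s \<in> S. s < K}"
    proof (intro equalityI subsetI)
      fix s assume "s \<in> {s \<in> S. s < K}"
      then obtain x t where "x \<in> apery" "s = x + t * m" "s < K"
        using apery_decomposition by blast
      then show "s \<in> (\<lambda>(x, t). x + t * m) ` (SIGMA x:apery. {..<lev x})"
        using less_lev_iff by (intro image_eqI[of _ _ "(x, t)"]) auto
    qed (auto simp: less_lev_iff add_mult_closed apery_def)
  qed
  then have "card {s \<in> S. s < K} = card (SIGMA x:apery. {..<lev x})"
    by (simp add: bij_betw_same_card)
  then show ?thesis using finite_apery by simp
qed

section \<open>Generators and embedding dimension\<close>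

text \<open>Such a \<open>z\<close> is not a sum of two nonzero elements of \<open>S\<close>, so
  \<open>S - {z}\<close> is still a submonoid. If it contained \<open>A\<close>, it would contain
  the hull \<open>S\<close>.\<close>

lemma irreducible_in_generators:
  assumes A: "add_submonoid hull A = S" and z: "z \<in> insert m (apery - {0} - decomposables)"
  shows "z \<in> A"
proof (rule ccontr)
  assume "z \<notin> A"
  have irred: "a = 0 \<or> b = 0" if ab: "a \<in> S" "b \<in> S" "z = a + b" for a b
  proof (rule ccontr)
    assume "\<not> ?thesis"
    then have nz: "a \<noteq> 0" "b \<noteq> 0" by auto
    show False
    proof (cases "z = m")
      case True
      then show False using m_le[OF ab(1) nz(1)] nz ab by auto
    next
      case False
      then have zD: "z \<in> apery" "z \<notin> decomposables" using z by auto
      \<comment> \<open>An \<open>m\<close> split off from a term of the sum would also split off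
        from \<open>z\<close>.\<close>
      have "a \<in> apery"
      proof (rule ccontr)
        assume "a \<notin> apery"
        then obtain y where "y \<in> S" "a = y + m" using ab by (auto simp: apery_def)
        then have "z = (y + b) + m" "y + b \<in> S" using ab add_closed by auto
        then show False using zD by (auto simp: apery_def)
      qed
      moreover have "b \<in> apery"
      proof (rule ccontr)
        assume "b \<notin> apery"
        then obtain y where "y \<in> S" "b = y + m" using ab by (auto simp: apery_def)
        then have "z = (a + y) + m" "a + y \<in> S" using ab add_closed by auto
        then show False using zD by (auto simp: apery_def)
      qed
      ultimately show False using zD ab nz unfolding decomposables_def by blast
    qed
  qed
  have "z \<in> S" "z \<noteq> 0" using z m_in m_pos by (auto simp: apery_def)
  have "add_submonoid (S - {z})"
    unfolding add_submonoid_def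
  proof (intro conjI ballI)
    show "0 \<in> S - {z}" using zero \<open>z \<noteq> 0\<close> by auto
    fix a b assume "a \<in> S - {z}" "b \<in> S - {z}"
    then show "a + b \<in> S - {z}" using irred[of a b] add_closed[of a b] by auto
  qed
  moreover have "A \<subseteq> S - {z}" using hull_subset[of A add_submonoid] A \<open>z \<notin> A\<close> by auto
  ultimately have "S \<subseteq> S - {z}" using hull_minimal A by metis
  then show False using \<open>z \<in> S\<close> by auto
qed

text \<open>Elements above \<open>K + m\<close> arise from smaller ones by adding \<open>m\<close>.
  The \<open>LEAST\<close> in \<open>embdim\<close> needs this existence.\<close>

lemma finitely_generated: "\<exists>A. finite A \<and> add_submonoid hull A = S"
proof (intro exI conjI)
  define A where "A = {s \<in> S. s \<le> K + m}"
  show "finite A" unfolding A_def by simp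
  have S: "add_submonoid S" using zero add_closed by (auto simp: add_submonoid_def)
  have gen: "A \<subseteq> T \<Longrightarrow> add_submonoid T \<Longrightarrow> s \<in> S \<Longrightarrow> s \<in> T" for s T
  proof (induction s rule: less_induct)
    case (less s)
    show ?case
    proof (cases "s \<le> K + m")
      case True
      then show ?thesis using less A_def by auto
    next
      case False
      then have "s - m \<in> T" using less m_pos conductor by auto
      moreover have "m \<in> T" using less m_in A_def by auto
      ultimately have "(s - m) + m \<in> T" using less.prems(2) unfolding add_submonoid_def by blast
      then show ?thesis using False by auto
    qed
  qed
  show "add_submonoid hull A = S"
  proof (rule hull_unique)
    show "A \<subseteq> S" by (auto simp: A_def)
    show "S \<subseteq> T" if "A \<subseteq> T" "add_submonoid T" for T using gen that by blast
  qed (rule S)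
qed

lemma card_irreducible_le_embdim:
  "card (insert m (apery - {0} - decomposables)) \<le> embdim S"
proof -
  have "\<exists>k A. finite A \<and> card A = k \<and> add_submonoid hull A = S"
    using finitely_generated by blast
  then obtain A where A: "finite A" "card A = embdim S" "add_submonoid hull A = S"
    unfolding embdim_def using LeastI_ex[of "\<lambda>k. \<exists>A. finite A \<and> card A = k \<and> add_submonoid hull A = S"] by blast
  have "insert m (apery - {0} - decomposables) \<subseteq> A"
    using irreducible_in_generators[OF A(3)] by blast
  then show ?thesis using A card_mono by metis
qed

text \<open>Of the \<open>m - 1\<close> nonzero Apery elements, those that are not decomposable lie,
  together with \<open>m\<close>, in every generating set.\<close>

lemma m_le_embdim: "m \<le> embdim S + card decomposables"
proof -
  have D: "decomposables \<subseteq> apery - {0}" using apery_greater by (fastforce simp: decomposables_def)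
  then have "finite decomposables" using finite_apery finite_subset by blast
  have "m \<notin> apery" using zero by (auto simp: apery_def)
  then have "card (insert m (apery - {0} - decomposables)) = Suc (card (apery - {0} - decomposables))"
    using finite_apery by (intro card_insert_disjoint) auto
  also have "card (apery - {0} - decomposables) = m - 1 - card decomposables"
    using D \<open>finite decomposables\<close> card_apery zero_in_apery finite_apery
    by (simp add: card_Diff_subset)
  finally show ?thesis using card_irreducible_le_embdim m_pos by linarith
qed

lemma card_generators_le_embdim:
  assumes "X \<subseteq> apery - {0} - decomposables" "finite X"
  shows "Suc (card X) \<le> embdim S"
proof -
  have "m \<notin> X" using zero assms(1) unfolding apery_def by force
  then have "Suc (card X) = card (insert m X)" using assms by simp
  also have "\<dots> \<le> card (insert m (apery - {0} - decomposables))"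
    using assms finite_apery by (intro card_mono) auto
  finally show ?thesis using card_irreducible_le_embdim by linarith
qed

section \<open>Level inequalities\<close>

text \<open>Adding \<open>lev_bound\<close> for \<open>x\<close> and \<open>y\<close> gives
  \<open>K < (lev x + lev y + 1) * m\<close>, while \<open>\<rho> < m\<close> gives
  \<open>q * m < K + m\<close>.\<close>

lemma lev_add_ge:
  assumes "x + y < K + m" "K + \<rho> = q * m" "\<rho> < m"
  shows "q \<le> lev x + lev y + 1"
proof (rule ccontr)
  assume "\<not> ?thesis"
  then have "(lev x + lev y + 2) * m \<le> q * m" by (intro mult_right_mono) auto
  then show False
    using lev_bound[of x] lev_bound[of y] assms by (simp add: algebra_simps)
qed

text \<open>Here \<open>x + lev x * m\<close> is the least element of \<open>x + m\<nat>\<close> that is at least \<open>K\<close>; when the bound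
  on the levels is attained, these two elements exceed \<open>K\<close> by less than \<open>\<rho>\<close> in total.\<close>

lemma lev_add_eq:
  assumes "x + y < K + m" "K + \<rho> = q * m" "lev x + lev y + 1 = q"
  shows "(x + lev x * m) + (y + lev y * m) + 1 \<le> 2 * K + \<rho>"
proof -
  have "K + \<rho> = lev x * m + lev y * m + m" using assms by (auto simp: algebra_simps)
  then show ?thesis using assms(1) by linarith
qed

lemma lev_antimono: "x \<le> y \<Longrightarrow> lev y \<le> lev x"
  unfolding lev_def by (intro div_le_mono) auto

lemma lev_zero:
  assumes "K + \<rho> = q * m" "\<rho> < m"
  shows "lev 0 = q"
proof (rule antisym)
  show "lev 0 \<le> q" using less_lev_iff[of q 0] assms by auto
  show "q \<le> lev 0"
  proof (rule ccontr)
    assume "\<not> ?thesis"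
    then have "(lev 0 + 1) * m \<le> q * m" by (intro mult_right_mono) auto
    then show False using lev_bound[of 0] assms by (simp add: algebra_simps)
  qed
qed

section \<open>Possible summands of decomposable elements\<close>

text \<open>By \<open>apery_le\<close>, both terms of a decomposable element lie here. Only the size
  of \<open>x + y\<close> is restricted, because the level estimates use nothing else about
  it.\<close>

definition summands :: "nat set" where
  "summands = {y \<in> apery - {0}. \<exists>x\<in>apery - {0}. x + y < K + m}"

lemma summands_subset: "summands \<subseteq> apery - {0}"
  unfolding summands_def by blast

lemma finite_summands: "finite summands"
  using finite_apery by (auto simp: summands_def)

text \<open>The partner \<open>x\<close> exceeds \<open>m\<close>, which leaves
  \<open>y < K\<close>.\<close>

lemma lev_summand_pos:
  assumes "y \<in> summands"
  shows "0 < lev y"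
proof -
  obtain x where "x \<in> apery - {0}" "x + y < K + m" using assms unfolding summands_def by blast
  then show ?thesis using apery_greater[of x] less_lev_iff[of 0 y] by auto
qed

lemma decomposablesE:
  assumes "z \<in> decomposables"
  obtains x y where "x \<in> summands" "y \<in> summands" "x \<le> y" "z = x + y" "x + y < K + m"
proof -
  obtain x y where xy: "x \<in> apery - {0}" "y \<in> apery - {0}" "z = x + y" "z \<in> apery"
    using assms unfolding decomposables_def by blast
  then have "x + y < K + m" using apery_le[of z] by auto
  then have "x \<in> summands" "y \<in> summands"
    using xy by (auto simp: summands_def add.commute)
  then show thesis using that[of x y] that[of y x] xy \<open>x + y < K + m\<close> by (cases "x \<le> y") auto
qed

text \<open>Partners are summands themselves, so the smallest summand can replace the partner of any
  \<open>y\<close>.\<close>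

lemma Min_summands_add:
  assumes "y \<in> summands"
  shows "Min summands + y < K + m"
proof -
  obtain x where x: "x \<in> apery - {0}" "x + y < K + m" using assms unfolding summands_def by blast
  then have "x \<in> summands" using assms by (auto simp: summands_def add.commute)
  then have "Min summands \<le> x" using finite_summands by simp
  then show ?thesis using x by linarith
qed

lemma Min_summands_not_decomposable:
  assumes "summands \<noteq> {}"
  shows "Min summands \<in> apery - {0} - decomposables"
proof (rule DiffI)
  have "Min summands \<in> summands" using assms finite_summands by (rule Min_in[rotated])
  then show "Min summands \<in> apery - {0}" using summands_subset by (rule rev_subsetD)
  show "Min summands \<notin> decomposables"
  proof
    assume "Min summands \<in> decomposables"
    then show False
    proof (rule decomposablesE)
      fix x y assume xy: "x \<in> summands" "y \<in> summands" "Min summands = x + y"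
      have "Min summands \<le> x" using finite_summands xy(1) by (rule Min_le)
      moreover have "y \<in> apery - {0}" using xy(2) summands_subset by (rule rev_subsetD)
      then have "y \<noteq> 0" by simp
      ultimately show False using xy(3) by linarith
    qed
  qed
qed

text \<open>The minimum and any other summand have levels adding up to at least
  \<open>q - 1\<close>; each of the rest contributes at least 1.\<close>

lemma sum_lev_summands_ge:
  assumes "K + \<rho> = q * m" "\<rho> < m" "2 \<le> card summands"
  shows "q + card summands \<le> (\<Sum>x\<in>summands. lev x) + 3"
proof -
  let ?c = "Min summands"
  have c: "?c \<in> summands" using assms finite_summands by (metis Min_in card.empty not_numeral_le_zero)
  have "summands - {?c} \<noteq> {}"
    using assms(3) c finite_summands by (metis One_nat_def Suc_1 card.empty card_Suc_Diff1 not_less_eq_eq le_refl)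
  then obtain y where y: "y \<in> summands - {?c}" by blast
  have "(\<Sum>x\<in>summands. lev x) = lev ?c + (lev y + (\<Sum>x\<in>summands - {?c} - {y}. lev x))"
    using c y finite_summands by (simp add: sum.remove)
  moreover have "(\<Sum>x\<in>summands - {?c} - {y}. 1) \<le> (\<Sum>x\<in>summands - {?c} - {y}. lev x)"
    using lev_summand_pos by (intro sum_mono) (auto simp: Suc_le_eq)
  moreover have "card (summands - {?c} - {y}) = card summands - 2"
    using c y finite_summands by simp
  moreover have "q \<le> lev ?c + lev y + 1"
    using lev_add_ge Min_summands_add y assms by blast
  ultimately show ?thesis using assms(3) by simp
qed

section \<open>The cases of one, two and three summands\<close>

text \<open>Adding \<open>q * embdim S\<close> turns a bound of this form into Wilf's inequality.
  Only \<open>c + c\<close> can be decomposable, so \<open>m - embdim S\<close> is at most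
  1.\<close>

lemma wilf_one_summand:
  assumes K: "K + \<rho> = q * m" "\<rho> < m"
    and T: "summands = {c}"
    and E: "m - embdim S \<le> card decomposables"
    and \<nu>: "2 \<le> embdim S"
  shows "q * (m - embdim S) \<le> embdim S * lev c + \<rho>"
proof -
  have "decomposables \<subseteq> {c + c}"
    using T by (auto elim!: decomposablesE)
  then have "card decomposables \<le> 1" using card_mono[of "{c + c}"] by simp
  then have "m - embdim S \<le> 1" using E by linarith
  then have "q * (m - embdim S) \<le> q * 1" by (intro mult_left_mono) auto
  moreover have cc: "c + c < K + m" using Min_summands_add[of c] T by simp
  have "q \<le> 2 * lev c + \<rho>"
  \<comment> \<open>Equality leaves a deficit of 1, which \<open>lev_add_eq\<close> covers by
    forcing \<open>1 \<le> \<rho>\<close>.\<close>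
  proof (cases "lev c + lev c + 1 = q")
    case True
    then show ?thesis using lev_add_eq[OF cc K(1)] lev_bound[of c] by linarith
  next
    case False
    then show ?thesis using lev_add_ge[OF cc K] by linarith
  qed
  moreover have "2 * lev c \<le> embdim S * lev c" using \<nu> by (intro mult_right_mono) auto
  ultimately show ?thesis by linarith
qed

text \<open>The three sums of \<open>c1\<close> and \<open>c2\<close> give
  \<open>m - embdim S \<le> 3\<close>. If \<open>B = q - 1\<close>, the deficit has to be covered by
  \<open>\<rho>\<close>.\<close>

lemma wilf_two_summands:
  assumes K: "K + \<rho> = q * m" "\<rho> < m"
    and T: "summands = {c1, c2}" "c1 < c2"
    and E: "m - embdim S \<le> card decomposables"
    and \<nu>: "2 \<le> embdim S"
    and B: "lev c1 + lev c2 \<le> B" "B \<le> q"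
    and hyp: "q * (m - embdim S) \<le> embdim S * (q + 1)"
  shows "q * (m - embdim S) \<le> embdim S * B + \<rho>"
proof -
  define e where "e = m - embdim S"
  have c1: "Min summands = c1" using T by simp
  have c12: "c1 + c2 < K + m" using Min_summands_add[of c2] c1 T by simp
  have pos: "0 < lev c1" "0 < lev c2" using lev_summand_pos T by auto
  have ge: "q \<le> lev c1 + lev c2 + 1" using lev_add_ge[OF c12 K] .
  have le: "lev c2 \<le> lev c1" using T lev_antimono by simp
  have bd: "K \<le> c1 + lev c1 * m" "K \<le> c2 + lev c2 * m" using lev_bound by auto
  consider "e \<le> 2" | "3 \<le> e" by linarith
  then have "q * e \<le> embdim S * B + \<rho>"
  proof cases
    case 1
    then have qe: "q * e \<le> q * 2" by (intro mult_left_mono) auto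
    have \<nu>B: "2 * B \<le> embdim S * B" using \<nu> by (intro mult_right_mono) auto
    have ap: "c1 \<in> apery" "c2 \<in> apery" using T by (auto simp: summands_def)
    \<comment> \<open>The classes mod \<open>m\<close> differ, so these two numbers cannot both
      equal \<open>K\<close>; in the equality case this raises the bound on \<open>\<rho>\<close> to
      2.\<close>
    have ne: "c1 + lev c1 * m \<noteq> c2 + lev c2 * m"
      using apery_mod_inj[OF ap] T(2) by (metis mod_mult_self1 less_irrefl)
    show ?thesis
    proof (cases "q \<le> B")
      case True
      then show ?thesis using qe \<nu>B by linarith
    next
      case False
      then have eq: "lev c1 + lev c2 + 1 = q" "B + 1 = q" using ge B by auto
      then have "2 \<le> \<rho>" using lev_add_eq[OF c12 K(1) eq(1)] bd ne by linarith
      then show ?thesis using qe \<nu>B eq by linarith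
    qed
  next
    case 2
    have D: "z \<in> {c1 + c1, c1 + c2, c2 + c2}" "z = c2 + c2 \<longrightarrow> c2 + c2 < K + m"
      if "z \<in> decomposables" for z
      using that T by (auto elim!: decomposablesE)
    have "card decomposables \<le> card {c1 + c1, c1 + c2, c2 + c2}"
      using D by (intro card_mono) auto
    then have e3: "e = 3" using 2 E e_def T by (simp add: card_insert_if split: if_splits)
    have c22: "c2 + c2 < K + m"
    proof (rule ccontr)
      assume "\<not> ?thesis"
      then have "decomposables \<subseteq> {c1 + c1, c1 + c2}" using D by fastforce
      then have "card decomposables \<le> card {c1 + c1, c1 + c2}" by (intro card_mono) auto
      then show False using 2 E e_def T by (simp add: card_insert_if split: if_splits)
    qed
    have ge2: "q \<le> lev c2 + lev c2 + 1" using lev_add_ge[OF c22 K] .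
    have q2: "2 \<le> q" using pos B by linarith
    \<comment> \<open>If \<open>embdim S\<close> were 2, then \<open>q = 2\<close> and
      \<open>c2 < 2 * m\<close>, too small for a sum of two elements above \<open>m\<close>. So
      \<open>m\<close>, \<open>c1\<close>, \<open>c2\<close> would be three necessary
      generators.\<close>
    have \<nu>3: "3 \<le> embdim S"
    proof (rule ccontr)
      assume "\<not> ?thesis"
      then have n2: "embdim S = 2" using \<nu> by linarith
      then have "q * 3 \<le> 2 * q + 2" using hyp e3 e_def by simp
      then have "q = 2" using q2 by simp
      then have "c2 < 2 * m" using less_lev_iff[of 0 c2] pos K by auto
      have "c2 \<notin> decomposables"
      proof
        assume "c2 \<in> decomposables"
        then obtain x y where "x \<in> summands" "y \<in> summands" "c2 = x + y"
          by (elim decomposablesE)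
        then have "m < x" "m < y" using apery_greater summands_subset by blast+
        then show False using \<open>c2 = x + y\<close> \<open>c2 < 2 * m\<close> by linarith
      qed
      moreover have "c1 \<notin> decomposables" "{c1, c2} \<subseteq> apery - {0}"
        using Min_summands_not_decomposable c1 T summands_subset by auto
      ultimately have "Suc (card {c1, c2}) \<le> embdim S"
        by (intro card_generators_le_embdim) auto
      then show False using n2 T by simp
    qed
    then have \<nu>B: "3 * B \<le> embdim S * B" by (intro mult_right_mono) auto
    show ?thesis
    proof (cases "q \<le> B")
      case True
      then show ?thesis using \<nu>B unfolding e3 by linarith
    next
      case False
      then have eq: "lev c1 = lev c2" "lev c2 + lev c2 + 1 = q" "B + 1 = q"
        using ge ge2 le B by auto
      \<comment> \<open>Since \<open>c1 < c2\<close> have equal levels,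
        \<open>c2 + lev c2 * m\<close> is at least \<open>K + 1\<close>, and it enters
        twice.\<close>
      then have "3 \<le> \<rho>" using lev_add_eq[OF c22 K(1) eq(2)] bd T(2) eq(1) by (auto simp: eq)
      then show ?thesis using \<nu>B eq unfolding e3 by linarith
    qed
  qed
  then show ?thesis by (simp add: e_def)
qed

text \<open>From \<open>lev c1 + lev c2 \<ge> q - 1\<close> and \<open>lev c3 \<ge> 1\<close>
  follows \<open>B = q\<close>, which settles \<open>m - embdim S \<le> embdim S\<close>. Otherwise,
  counting sums and levels leaves only \<open>q = 3\<close>.\<close>

lemma wilf_three_summands:
  assumes K: "K + \<rho> = q * m" "\<rho> < m"
    and T: "summands = {c1, c2, c3}" "c1 < c2" "c2 < c3"
    and E: "m - embdim S \<le> card decomposables"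
    and B: "lev c1 + lev c2 + lev c3 \<le> B" "B \<le> q"
    and hyp: "q * (m - embdim S) \<le> embdim S * (q + 1)"
  shows "q * (m - embdim S) \<le> embdim S * B + \<rho>"
proof -
  define e where "e = m - embdim S"
  have c1: "Min summands = c1" using T by simp
  have c13: "c1 + c3 < K + m" using Min_summands_add[of c3] c1 T by simp
  then have c12: "c1 + c2 < K + m" using T by simp
  have pos: "0 < lev c1" "0 < lev c2" "0 < lev c3" using lev_summand_pos T by auto
  have ge: "q \<le> lev c1 + lev c2 + 1" "q \<le> lev c1 + lev c3 + 1"
    using lev_add_ge[OF c12 K] lev_add_ge[OF c13 K] by auto
  have Bq: "B = q" and q3: "3 \<le> q" using B ge pos by auto
  have "q * e \<le> embdim S * B + \<rho>"
  proof (cases "e \<le> embdim S")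
    case True
    then have "q * e \<le> q * embdim S" by (intro mult_left_mono) auto
    then show ?thesis unfolding Bq by (metis mult.commute trans_le_add1)
  next
    case False
    then have "(embdim S + 1) * (q + 1) \<le> e * (q + 1)" by (intro mult_right_mono) auto
    then have eq1: "q + 1 \<le> e" using hyp unfolding e_def[symmetric] by (simp add: algebra_simps)
    have D: "z \<in> {c1 + c1, c1 + c2, c1 + c3, c2 + c2} \<or>
             z \<in> {c2 + c3, c3 + c3} \<and> c2 + c3 < K + m" if "z \<in> decomposables" for z
      using that T by (auto elim!: decomposablesE)
    have "card decomposables \<le> card (set [c1 + c1, c1 + c2, c1 + c3, c2 + c2, c2 + c3, c3 + c3])"
      using D by (intro card_mono) auto
    also have "\<dots> \<le> 6" by (rule order_trans[OF card_length]) simp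
    finally have e6: "e \<le> 6" using E e_def by simp
    \<comment> \<open>If \<open>c2\<close> and \<open>c3\<close> can be paired, their levels, both
      1, give \<open>q - 1 \<le> 2\<close>. If not, at most four sums remain, against
      \<open>q + 1 \<le> e\<close>.\<close>
    have "q = 3"
    proof (cases "c2 + c3 < K + m")
      case True
      then show ?thesis using lev_add_ge[OF True K] ge B q3 by linarith
    next
      case False
      have "card decomposables \<le> card (set [c1 + c1, c1 + c2, c1 + c3, c2 + c2])"
        using D False by (intro card_mono) auto
      also have "\<dots> \<le> 4" by (rule order_trans[OF card_length]) simp
      finally show ?thesis using E e_def eq1 q3 by simp
    qed
    then have lev1: "lev c1 = 1" "lev c3 = 1" using B pos by auto
    have "lev c1 + lev c3 + 1 = q" using lev1 \<open>q = 3\<close> by simp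
    \<comment> \<open>As \<open>c3 \<ge> c1 + 2\<close> at equal level,
      \<open>c3 + lev c3 * m\<close> is at least \<open>K + 2\<close>.\<close>
    from lev_add_eq[OF c13 K(1) this] have "3 \<le> \<rho>"
      using lev_bound[of c1] T lev1 by simp
    moreover have "3 * e \<le> 4 * embdim S" using hyp \<open>q = 3\<close> unfolding e_def[symmetric] by simp
    \<comment> \<open>The excess of \<open>e\<close> over \<open>embdim S\<close> is at most
      \<open>e / 4\<close>, hence below 2; one unit of excess costs \<open>q = 3\<close>, which
      \<open>\<rho>\<close> pays.\<close>
    then have "e \<le> embdim S + 1" using e6 by presburger
    ultimately show ?thesis using Bq \<open>q = 3\<close> by simp
  qed
  then show ?thesis by (simp add: e_def)
qed

section \<open>Wilf's inequality for large embedding dimension\<close>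

lemma wilf_large_embdim:
  assumes K: "K + \<rho> = q * m" "\<rho> < m"
    and hyp: "q * m \<le> (2 * q + 1) * embdim S"
  shows "K \<le> embdim S * card {s \<in> S. s < K}"
proof -
  define B where "B = (\<Sum>x\<in>apery - {0}. lev x)"
  define \<nu> where "\<nu> = embdim S"
  have n: "card {s \<in> S. s < K} = q + B"
    unfolding card_below_conductor B_def lev_zero[OF K, symmetric]
    using finite_apery zero_in_apery by (rule sum.remove)
  have E: "m - \<nu> \<le> card decomposables" using m_le_embdim \<nu>_def by simp
  have sumB: "(\<Sum>x\<in>summands. lev x) \<le> B"
    unfolding B_def using finite_apery by (intro sum_mono2) (auto simp: summands_def)
  show ?thesis
  proof (cases "B \<le> q")
    case False
    \<comment> \<open>Here \<open>n = q + B\<close> is at least \<open>2 * q + 1\<close>, so the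
      hypothesis suffices directly.\<close>
    then have "(2 * q + 1) * \<nu> \<le> (q + B) * \<nu>" by (intro mult_right_mono) auto
    then show ?thesis using hyp K n \<nu>_def by (simp add: mult.commute)
  next
    case True
    have hyp': "q * (m - \<nu>) \<le> \<nu> * (q + 1)"
      using hyp unfolding \<nu>_def by (simp add: algebra_simps diff_mult_distrib2)
    have \<nu>2: "2 \<le> \<nu>" if "summands \<noteq> {}"
      using card_generators_le_embdim[of "{Min summands}"] Min_summands_not_decomposable[OF that]
      by (simp add: \<nu>_def)
    have "card summands \<le> 3"
      using sum_lev_summands_ge[OF K] sumB True by (cases "2 \<le> card summands") auto
    then consider "card summands = 0" | "card summands = 1" | "card summands = 2"
      | "card summands = 3" by linarith
    then have "q * (m - \<nu>) \<le> \<nu> * B + \<rho>"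
    proof cases
      case 1
      then have "decomposables = {}" using finite_summands by (auto elim!: decomposablesE)
      then show ?thesis using E by simp
    next
      case 2
      then obtain c where T: "summands = {c}" by (auto simp: card_1_singleton_iff)
      then have "\<nu> * lev c \<le> \<nu> * B" using sumB by (intro mult_left_mono) auto
      moreover have "q * (m - \<nu>) \<le> \<nu> * lev c + \<rho>"
        using wilf_one_summand[OF K T] E \<nu>2 T \<nu>_def by simp
      ultimately show ?thesis by linarith
    next
      case 3
      then obtain a b where "summands = {a, b}" "a \<noteq> b" by (auto simp: card_2_iff)
      then obtain c1 c2 where T: "summands = {c1, c2}" "c1 < c2"
        by (metis insert_commute linorder_neqE_nat)
      then show ?thesis using wilf_two_summands[OF K T] E \<nu>2 sumB True hyp' \<nu>_def by simp
    next
      case 4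
      then obtain c1 c2 c3 where T: "summands = {c1, c2, c3}" "c1 < c2" "c2 < c3"
        by (rule card_3_sorted)
      then show ?thesis using wilf_three_summands[OF K T] E sumB True hyp' \<nu>_def
        by (simp add: add.assoc)
    qed
    \<comment> \<open>An inequality because \<open>m - \<nu>\<close> truncates to 0 when
      \<open>m < \<nu>\<close>.\<close>
    moreover have "q * m \<le> q * (\<nu> + (m - \<nu>))" by (intro mult_left_mono) auto
    ultimately have "K + \<rho> \<le> q * \<nu> + \<nu> * B + \<rho>" using K by (simp add: algebra_simps)
    then show ?thesis using n \<nu>_def by (simp add: algebra_simps)
  qed
qed

end

section \<open>From the Frobenius number to the conductor\<close>

text \<open>\<open>K\<close> is \<open>f + 1\<close> as a natural number, which is 0 for
  \<open>S = UNIV\<close>. As \<open>f\<close> is not in \<open>S\<close>, counting below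
  \<open>f\<close> and below \<open>K\<close> agree.\<close>

lemma frobenius_conductor:
  assumes "finite (- S)"
  obtains K where "frobenius S = int K - 1" "\<And>s. K \<le> s \<Longrightarrow> s \<in> S"
    "num_left S = card {s \<in> S. s < K}"
proof -
  define K where "K = (LEAST k. \<forall>s\<ge>k. s \<in> S)"
  have "\<exists>k. \<forall>s\<ge>k. s \<in> S"
    using assms by (metis ComplI finite_nat_set_iff_bounded leD)
  then have K: "\<forall>s\<ge>K. s \<in> S" unfolding K_def by (rule LeastI_ex)
  have gap: "int K - 1 \<notin> int ` S"
  proof
    assume "int K - 1 \<in> int ` S"
    then obtain s where s: "s \<in> S" "K = Suc s" by auto
    then have "\<forall>t\<ge>s. t \<in> S" using K by (metis le_antisym not_less_eq_eq)
    then have "K \<le> s" unfolding K_def by (rule Least_le)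
    then show False using s by simp
  qed
  have fr: "frobenius S = int K - 1"
    unfolding frobenius_def
  proof (rule Greatest_equality)
    fix z assume z: "z \<notin> int ` S"
    show "z \<le> int K - 1"
    proof (rule ccontr)
      assume "\<not> ?thesis"
      then have "nat z \<in> S" "z = int (nat z)" using K by auto
      then show False using z by blast
    qed
  qed (rule gap)
  have "{s \<in> S. int s < frobenius S} = {s \<in> S. s < K}"
  proof (intro Collect_cong conj_cong refl)
    fix s assume "s \<in> S"
    then have "int s \<noteq> int K - 1" using gap by (metis image_eqI)
    then show "int s < frobenius S \<longleftrightarrow> s < K" unfolding fr by linarith
  qed
  then show thesis using that[OF fr] K by (simp add: num_left_def)
qed

theorem theorem3:
  fixes S :: "nat set" and m \<nu> n q \<rho> :: nat and f :: int
  assumes "numerical_semigroup S"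
    and "m = min_nonzero S"
    and "\<nu> = embdim S"
    and "f = frobenius S"
    and "n = num_left S"
    and "f + 1 = int q * int m - int \<rho>"
    and "0 \<le> \<rho>" and "\<rho> \<le> m - 1"
    and "(2 + 1 / real q) * real \<nu> \<ge> real m"
  shows "f + 1 \<le> int \<nu> * int n"
proof -
  have S: "add_submonoid S" "finite (- S)" using assms(1) by (auto simp: numerical_semigroup_def)
  obtain K where K: "frobenius S = int K - 1" "\<And>s. K \<le> s \<Longrightarrow> s \<in> S"
    "num_left S = card {s \<in> S. s < K}"
    using frobenius_conductor[OF S(2)] by metis
  \<comment> \<open>A witness for the \<open>LEAST\<close> in \<open>min_nonzero\<close>;
    \<open>K\<close> itself may be 0.\<close>
  have "Suc K \<in> S \<and> Suc K \<noteq> 0" using K(2) by simp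
  then have m: "m \<in> S \<and> m \<noteq> 0" unfolding assms(2) min_nonzero_def by (rule LeastI)
  interpret semigroup_with_conductor S m K
  proof
    show "m \<le> s" if "s \<in> S" "s \<noteq> 0" for s
      unfolding assms(2) min_nonzero_def using that by (intro Least_le) simp
  qed (use S(1) m K(2) in \<open>auto simp: add_submonoid_def\<close>)
  have "int (K + \<rho>) = int (q * m)" using assms(4,6) K(1) by simp
  then have K\<rho>: "K + \<rho> = q * m" by (simp only: of_nat_eq_iff)
  \<comment> \<open>The strict bound relies on \<open>m \<noteq> 0\<close>, because
    \<open>m - 1\<close> truncates.\<close>
  have \<rho>: "\<rho> < m" using assms(8) m by linarith
  show ?thesis
  proof (cases "q = 0")
    \<comment> \<open>Here \<open>1 / real q\<close> is 0 by convention, and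
      \<open>f + 1 = - \<rho>\<close> is not positive.\<close>
    case True
    then have "f + 1 \<le> 0" using assms(6) by simp
    also have "0 \<le> int \<nu> * int n" by simp
    finally show ?thesis .
  next
    case False
    have "real q * real m \<le> real q * ((2 + 1 / real q) * real \<nu>)"
      using assms(9) by (intro mult_left_mono) auto
    also have "\<dots> = (2 * real q + 1) * real \<nu>" using False by (simp add: field_simps)
    finally have "real (q * m) \<le> real ((2 * q + 1) * \<nu>)" by (simp add: algebra_simps)
    then have "q * m \<le> (2 * q + 1) * embdim S" using assms(3) by (simp only: of_nat_le_iff)
    then have "K \<le> \<nu> * n" using wilf_large_embdim[OF K\<rho> \<rho>] K(3) assms(3,5) by simp
    then have "int K \<le> int (\<nu> * n)" by (simp only: of_nat_le_iff)
    then show ?thesis using K(1) assms(4) by simp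
  qed
qed

end
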